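(* Let $R$ be a commutative ring with identity and let $M=M_1\oplus M_2\oplus\cdots\oplus M_n$ be an $R$-module that is a direct sum of submodules $M_i$ $(1\le i\le n)$. Then the following are equivalent: (1) $M$ is weakly IN; (2) (a) $M_i$ is a weakly IN $R$-module for all $i\in\{1,\dots,n\}$, and (b) $\mathrm{Ann}_R(M_j)+\mathrm{Ann}_R(M_k)=R$ for all $j\neq k$ in $\{1,\dots,n\}$.
   Context: All rings are commutative with identity and all modules are unital. For an $R$-module $N$, $\mathrm{Ann}_R(N)=\{r\in R\mid rN=0\}$. An $R$-module $M$ is weakly IN if $\mathrm{Ann}_R(N)+\mathrm{Ann}_R(L)=R$ for all submodules $N,L$ of $M$ with $N\cap L=0$. *)

theory Defs
  imports "HOL-Algebra.Module" "HOL-Algebra.AbelCoset"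
begin

definition module_ann ::
  "('a, 'c) ring_scheme \<Rightarrow> ('a, 'b, 'd) module_scheme \<Rightarrow> 'b set \<Rightarrow> 'a set" where
  "module_ann R M N = {r \<in> carrier R. \<forall>x\<in>N. r \<odot>\<^bsub>M\<^esub> x = \<zero>\<^bsub>M\<^esub>}"

definition weakly_IN ::
  "('a, 'c) ring_scheme \<Rightarrow> ('a, 'b, 'd) module_scheme \<Rightarrow> bool" where
  "weakly_IN R M \<longleftrightarrow>
     (\<forall>N L. submodule N R M \<longrightarrow> submodule L R M \<longrightarrow> N \<inter> L = {\<zero>\<^bsub>M\<^esub>} \<longrightarrow>
        module_ann R M N <+>\<^bsub>R\<^esub> module_ann R M L = carrier R)"

(* Internal direct sum. The extensional function space makes the family of components
   of an element unique as a function, not only on the index set. Finiteness is demanded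
   because finsum is zero over an infinite index set. *)
definition is_direct_sum ::
  "('a, 'c) ring_scheme \<Rightarrow> ('a, 'b, 'd) module_scheme \<Rightarrow> 'i set \<Rightarrow> ('i \<Rightarrow> 'b set) \<Rightarrow> bool" where
  "is_direct_sum R M I S \<longleftrightarrow>
     finite I \<and> (\<forall>i\<in>I. submodule (S i) R M) \<and>
     (\<forall>x\<in>carrier M. \<exists>!f. f \<in> (\<Pi>\<^sub>E i\<in>I. S i) \<and> x = (\<Oplus>\<^bsub>M\<^esub>i\<in>I. f i))"

end

theory Submission
  imports Defs "HOL-Algebra.Ideal"
begin

text \<open>
  For a direct sum \<open>M\<close> of submodules \<open>S i\<close>, the necessity of the two conditions is immediate:
  submodules of a summand are submodules of \<open>M\<close>, and two different summands meet in zero.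

  For sufficiency, let \<open>N\<close> and \<open>L\<close> be submodules of \<open>M\<close> meeting in zero and let \<open>Q\<close> be the ideal
  \<open>Ann N + Ann L\<close>. Fix \<open>i\<close>. Because \<open>Ann (S i)\<close> is comaximal with every other \<open>Ann (S j)\<close>, it is
  comaximal with their intersection, so \<open>1 = d + c\<close> where \<open>d\<close> kills \<open>S i\<close> and \<open>c\<close> kills all the
  other summands. Multiplication by such a \<open>c\<close> maps \<open>M\<close> into \<open>S i\<close>, hence \<open>N\<close> into \<open>N \<inter> S i\<close> and
  \<open>L\<close> into \<open>L \<inter> S i\<close>. These two submodules of \<open>S i\<close> meet in zero, so weak INness of \<open>S i\<close> gives
  \<open>1 = a + b\<close> where \<open>a\<close> kills \<open>N \<inter> S i\<close> and \<open>b\<close> kills \<open>L \<inter> S i\<close>. Then \<open>a c\<close> kills \<open>N\<close> and \<open>b c\<close>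
  kills \<open>L\<close>, so \<open>c = a c + b c\<close> is in \<open>Q\<close>, and \<open>1 = c + d\<close> shows that \<open>Q\<close> is comaximal with
  \<open>Ann (S i)\<close>. As this holds for every \<open>i\<close>, the ideal \<open>Q\<close> is also comaximal with the intersection
  of all \<open>Ann (S i)\<close>. That intersection is \<open>Ann M\<close>, which is contained in \<open>Q\<close>; therefore \<open>Q\<close> is
  the whole ring. The passage from comaximality with each of finitely many ideals to comaximality
  with their intersection (\<open>comaximal_Inter\<close>) is thus used twice.
\<close>

section \<open>Comaximal ideals\<close>

lemma (in ring) ideal_sum_eq_carrier_iff:
  assumes "ideal I R" "ideal J R"
  shows "I <+>\<^bsub>R\<^esub> J = carrier R \<longleftrightarrow> (\<exists>a\<in>I. \<exists>b\<in>J. a \<oplus> b = \<one>)"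
proof
  assume "I <+>\<^bsub>R\<^esub> J = carrier R"
  then have "\<one> \<in> I <+>\<^bsub>R\<^esub> J"
    by simp
  then show "\<exists>a\<in>I. \<exists>b\<in>J. a \<oplus> b = \<one>"
    unfolding set_add_def' by (auto dest: sym)
next
  assume "\<exists>a\<in>I. \<exists>b\<in>J. a \<oplus> b = \<one>"
  then have "\<one> \<in> I <+>\<^bsub>R\<^esub> J"
    by (force simp: set_add_def')
  then show "I <+>\<^bsub>R\<^esub> J = carrier R"
    using ideal.one_imp_carrier[OF add_ideals[OF assms]] by simp
qed

text \<open>
  If \<open>1 = q + s\<close> and \<open>1 = q' + t\<close> with \<open>q, q' \<in> Q\<close>, then \<open>1 = (q + s q') + s t\<close>, and the product
  \<open>s t\<close> lies in every ideal containing \<open>s\<close> or \<open>t\<close>. The conclusion speaks of elements because an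
  intersection over the empty family would have to be read relative to the carrier.
\<close>

lemma (in cring) comaximal_Inter:
  assumes "finite A" "ideal Q R"
    and "\<And>a. a \<in> A \<Longrightarrow> ideal (I a) R"
    and "\<And>a. a \<in> A \<Longrightarrow> Q <+>\<^bsub>R\<^esub> I a = carrier R"
  shows "\<exists>q\<in>Q. \<exists>r\<in>carrier R. (\<forall>a\<in>A. r \<in> I a) \<and> q \<oplus> r = \<one>"
  using assms(1,3,4)
proof (induction A rule: finite_induct)
  case empty
  interpret Q: ideal Q R by fact
  have "\<zero> \<oplus> \<one> = \<one>" by simp
  then show ?case
    using Q.zero_closed by blast
next
  case (insert x A)
  interpret Q: ideal Q R by fact
  interpret Ix: ideal "I x" R using insert.prems by simp
  obtain q s where q: "q \<in> Q" and s: "s \<in> carrier R" "\<forall>a\<in>A. s \<in> I a" and qs: "q \<oplus> s = \<one>"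
    using insert.IH insert.prems by auto
  obtain q' t where q': "q' \<in> Q" and t: "t \<in> I x" and qt: "q' \<oplus> t = \<one>"
    using ideal_sum_eq_carrier_iff[OF Q.is_ideal Ix.is_ideal] insert.prems(2)[of x] by auto
  have carr: "q \<in> carrier R" "q' \<in> carrier R" "t \<in> carrier R"
    using q q' t Q.Icarr Ix.Icarr by auto
  have "(q \<oplus> s \<otimes> q') \<oplus> s \<otimes> t = q \<oplus> s \<otimes> (q' \<oplus> t)"
    using carr s by (simp add: a_assoc r_distr)
  then have "(q \<oplus> s \<otimes> q') \<oplus> s \<otimes> t = \<one>"
    using qs qt s by simp
  moreover have "q \<oplus> s \<otimes> q' \<in> Q"
    using q q' s Q.I_l_closed by (simp add: Q.a_closed)
  moreover have "\<forall>a\<in>insert x A. s \<otimes> t \<in> I a"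
    using s t carr Ix.I_l_closed ideal.I_r_closed[OF insert.prems(1)] by auto
  ultimately show ?case
    using s carr by blast
qed

section \<open>Submodules and annihilators\<close>

context module
begin

lemma submodule_zero_closed:
  assumes "submodule H R M"
  shows "\<zero>\<^bsub>M\<^esub> \<in> H"
  using subgroup.one_closed[OF submodule.axioms(1)[OF assms]] by simp

lemma submodule_Int:
  assumes "submodule H R M" "submodule K R M"
  shows "submodule (H \<inter> K) R M"
  using submoduleE[OF assms(1)] submoduleE[OF assms(2)]
    submodule_zero_closed[OF assms(1)] submodule_zero_closed[OF assms(2)]
  by (intro submoduleI) auto

lemma zero_submodule: "submodule {\<zero>\<^bsub>M\<^esub>} R M"
  by (intro submoduleI) auto

lemma submodule_restrict_carrier_iff:
  assumes "submodule K R M"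
  shows "submodule H R (M\<lparr>carrier := K\<rparr>) \<longleftrightarrow> submodule H R M \<and> H \<subseteq> K"
proof
  assume H: "submodule H R (M\<lparr>carrier := K\<rparr>)"
  interpret K: module R "M\<lparr>carrier := K\<rparr>"
    using submodule.submodule_is_module[OF assms] module_axioms by blast
  have "module R (M\<lparr>carrier := H\<rparr>)"
    using submodule.submodule_is_module[OF H K.module_axioms] by simp
  moreover have "H \<subseteq> K"
    using K.submoduleE(1)[OF H] by simp
  ultimately show "submodule H R M \<and> H \<subseteq> K"
    using module_incl_imp_submodule submoduleE(1)[OF assms] by blast
next
  assume H: "submodule H R M \<and> H \<subseteq> K"
  interpret K: module R "M\<lparr>carrier := K\<rparr>"
    using submodule.submodule_is_module[OF assms] module_axioms by blast
  show "submodule H R (M\<lparr>carrier := K\<rparr>)"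
    using H submodule.submodule_is_module[of H R M] module_axioms
    by (intro K.module_incl_imp_submodule) auto
qed

lemma submodule_finsum_closed:
  assumes H: "submodule H R M" and "f \<in> A \<rightarrow> H"
  shows "(\<Oplus>\<^bsub>M\<^esub>i\<in>A. f i) \<in> H"
  using assms(2)
proof (induction A rule: infinite_finite_induct)
  case (insert x A)
  then have "f \<in> A \<rightarrow> carrier M" "f x \<in> carrier M"
    using submoduleE(1)[OF H] by auto
  with insert show ?case
    using submoduleE(5)[OF H] by (auto simp: Pi_iff)
qed (simp_all add: submodule_zero_closed[OF H])

lemma module_ann_ideal:
  assumes "N \<subseteq> carrier M"
  shows "ideal (module_ann R M N) R"
proof (rule idealI)
  show "ring R"
    by (rule R.ring_axioms)
  show "subgroup (module_ann R M N) (add_monoid R)"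
  proof (rule R.add.subgroupI)
    show "module_ann R M N \<subseteq> carrier R"
      by (auto simp: module_ann_def)
    have "\<zero> \<in> module_ann R M N"
      using assms by (auto simp: module_ann_def)
    then show "module_ann R M N \<noteq> {}"
      by blast
    show "\<ominus> a \<in> module_ann R M N" if "a \<in> module_ann R M N" for a
      using assms that by (auto simp: module_ann_def smult_l_minus subset_iff)
    show "a \<oplus> b \<in> module_ann R M N" if "a \<in> module_ann R M N" "b \<in> module_ann R M N" for a b
      using assms that by (auto simp: module_ann_def smult_l_distr subset_iff)
  qed
next
  fix a x
  assume "a \<in> module_ann R M N" "x \<in> carrier R"
  then show "x \<otimes> a \<in> module_ann R M N" "a \<otimes> x \<in> module_ann R M N"
    using assms by (auto simp: module_ann_def smult_assoc1 subset_iff R.m_comm[of a x])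
qed

lemma ann_sum_eq_carrier_iff:
  assumes "N \<subseteq> carrier M" "L \<subseteq> carrier M"
  shows "module_ann R M N <+>\<^bsub>R\<^esub> module_ann R M L = carrier R \<longleftrightarrow>
    (\<exists>a\<in>module_ann R M N. \<exists>b\<in>module_ann R M L. a \<oplus> b = \<one>)"
  using assms by (intro R.ideal_sum_eq_carrier_iff module_ann_ideal)

text \<open>
  Annihilators depend only on the scalar multiplication and the zero of the module, which a
  submodule shares with \<open>M\<close>; so weak INness of a submodule can be tested inside \<open>M\<close>.
\<close>

lemma weakly_IN_restrict_carrier_iff:
  assumes "submodule K R M"
  shows "weakly_IN R (M\<lparr>carrier := K\<rparr>) \<longleftrightarrow>
    (\<forall>N L. submodule N R M \<longrightarrow> submodule L R M \<longrightarrow> N \<subseteq> K \<longrightarrow> L \<subseteq> K \<longrightarrow> N \<inter> L = {\<zero>\<^bsub>M\<^esub>} \<longrightarrow>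
       module_ann R M N <+>\<^bsub>R\<^esub> module_ann R M L = carrier R)"
  using submodule_restrict_carrier_iff[OF assms]
  by (simp add: weakly_IN_def module_ann_def) blast

section \<open>Direct sums\<close>

lemma direct_sum_submodule:
  assumes "is_direct_sum R M I S" "i \<in> I"
  shows "submodule (S i) R M"
  using assms by (simp add: is_direct_sum_def)

text \<open>
  An element of \<open>S j \<inter> S k\<close> is the sum of the family concentrated at \<open>j\<close> and also of the family
  concentrated at \<open>k\<close>; by uniqueness the two families agree, and they can do so only if the
  element is zero.
\<close>

lemma direct_sum_Int_zero:
  assumes ds: "is_direct_sum R M I S" and jk: "j \<in> I" "k \<in> I" "j \<noteq> k"
  shows "S j \<inter> S k = {\<zero>\<^bsub>M\<^esub>}"
proof -
  have fin: "finite I"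
    and uniq: "\<And>x. x \<in> carrier M \<Longrightarrow> \<exists>!f. f \<in> (\<Pi>\<^sub>E i\<in>I. S i) \<and> x = (\<Oplus>\<^bsub>M\<^esub>i\<in>I. f i)"
    using ds by (auto simp: is_direct_sum_def)
  have zero: "\<And>i. i \<in> I \<Longrightarrow> \<zero>\<^bsub>M\<^esub> \<in> S i"
    using submodule_zero_closed direct_sum_submodule[OF ds] by blast
  have "x = \<zero>\<^bsub>M\<^esub>" if x: "x \<in> S j" "x \<in> S k" for x
  proof -
    have xM: "x \<in> carrier M"
      using submoduleE(1)[OF direct_sum_submodule[OF ds jk(1)]] x by auto
    define F where "F l = (\<lambda>i\<in>I. if i = l then x else \<zero>\<^bsub>M\<^esub>)" for l
    have rep: "F l \<in> (\<Pi>\<^sub>E i\<in>I. S i) \<and> x = (\<Oplus>\<^bsub>M\<^esub>i\<in>I. F l i)" if l: "l \<in> I" "x \<in> S l" for l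
    proof -
      have "(\<Oplus>\<^bsub>M\<^esub>i\<in>I. F l i) = (\<Oplus>\<^bsub>M\<^esub>i\<in>I. if l = i then x else \<zero>\<^bsub>M\<^esub>)"
        using xM by (intro M.finsum_cong') (auto simp: F_def)
      also have "\<dots> = x"
        using M.finsum_singleton[OF l(1) fin, of "\<lambda>_. x"] xM by auto
      finally show ?thesis
        using l zero by (auto simp: F_def)
    qed
    have "F j = F k"
      using uniq[OF xM] rep[OF jk(1) x(1)] rep[OF jk(2) x(2)] by blast
    then have "F j j = F k j"
      by simp
    then show ?thesis
      using jk by (simp add: F_def)
  qed
  then show ?thesis
    using zero jk by blast
qed

text \<open>
  The case \<open>H = S i\<close> shows that a scalar killing every summand except \<open>S i\<close> maps \<open>M\<close> into \<open>S i\<close>;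
  the case \<open>H = 0\<close> shows that a scalar killing every summand kills \<open>M\<close>.
\<close>

lemma direct_sum_smult_into_submodule:
  assumes ds: "is_direct_sum R M I S" and H: "submodule H R M" and r: "r \<in> carrier R"
    and rS: "\<And>i y. i \<in> I \<Longrightarrow> y \<in> S i \<Longrightarrow> r \<odot>\<^bsub>M\<^esub> y \<in> H"
    and x: "x \<in> carrier M"
  shows "r \<odot>\<^bsub>M\<^esub> x \<in> H"
proof -
  obtain f where f: "f \<in> (\<Pi>\<^sub>E i\<in>I. S i)" and xf: "x = (\<Oplus>\<^bsub>M\<^esub>i\<in>I. f i)"
    using ds x unfolding is_direct_sum_def by blast
  have "f \<in> I \<rightarrow> carrier M"
    using f submoduleE(1)[OF direct_sum_submodule[OF ds]] by fastforce
  then have "r \<odot>\<^bsub>M\<^esub> x = (\<Oplus>\<^bsub>M\<^esub>i\<in>I. r \<odot>\<^bsub>M\<^esub> f i)"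
    unfolding xf using ds r by (intro finsum_smult_ldistr) (auto simp: is_direct_sum_def)
  also have "\<dots> \<in> H"
    using f rS by (intro submodule_finsum_closed[OF H]) auto
  finally show ?thesis .
qed

text \<open>
  The heart of the argument: a scalar that kills every summand except \<open>S i\<close> moves \<open>N\<close> and \<open>L\<close>
  into \<open>S i\<close>, where the hypothesis on \<open>S i\<close> splits it into a part killing \<open>N\<close> and a part
  killing \<open>L\<close>.
\<close>

lemma direct_sum_scalar_in_ann_sum:
  assumes ds: "is_direct_sum R M I S" and i: "i \<in> I"
    and wIN: "weakly_IN R (M\<lparr>carrier := S i\<rparr>)"
    and N: "submodule N R M" and L: "submodule L R M" and NL: "N \<inter> L = {\<zero>\<^bsub>M\<^esub>}"
    and c: "c \<in> carrier R" "\<And>j. j \<in> I \<Longrightarrow> j \<noteq> i \<Longrightarrow> c \<in> module_ann R M (S j)"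
  shows "c \<in> module_ann R M N <+>\<^bsub>R\<^esub> module_ann R M L"
proof -
  note Si = direct_sum_submodule[OF ds i]
  have NLi: "(N \<inter> S i) \<inter> (L \<inter> S i) = {\<zero>\<^bsub>M\<^esub>}"
    using NL submodule_zero_closed[OF Si] by auto
  have sub: "N \<subseteq> carrier M" "L \<subseteq> carrier M"
    using submoduleE(1)[OF N] submoduleE(1)[OF L] by auto
  have "module_ann R M (N \<inter> S i) <+>\<^bsub>R\<^esub> module_ann R M (L \<inter> S i) = carrier R"
    using wIN[unfolded weakly_IN_restrict_carrier_iff[OF Si], rule_format,
        OF submodule_Int[OF N Si] submodule_Int[OF L Si] _ _ NLi] by simp
  then obtain a b where a: "a \<in> module_ann R M (N \<inter> S i)" and b: "b \<in> module_ann R M (L \<inter> S i)"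
    and ab: "a \<oplus> b = \<one>"
    using ann_sum_eq_carrier_iff[of "N \<inter> S i" "L \<inter> S i"] sub by blast
  have carr: "a \<in> carrier R" "b \<in> carrier R"
    using a b by (auto simp: module_ann_def)
  have into: "c \<odot>\<^bsub>M\<^esub> x \<in> S i" if "x \<in> carrier M" for x
  proof (rule direct_sum_smult_into_submodule[OF ds Si c(1) _ that])
    fix j y assume "j \<in> I" "y \<in> S j"
    then show "c \<odot>\<^bsub>M\<^esub> y \<in> S i"
      using c submoduleE(4)[OF Si] submodule_zero_closed[OF Si]
      by (cases "j = i") (auto simp: module_ann_def)
  qed
  have kill: "r \<otimes> c \<in> module_ann R M H"
    if H: "submodule H R M" and r: "r \<in> module_ann R M (H \<inter> S i)" for r H
  proof -
    have "(r \<otimes> c) \<odot>\<^bsub>M\<^esub> x = \<zero>\<^bsub>M\<^esub>" if "x \<in> H" for x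
    proof -
      have xM: "x \<in> carrier M" using submoduleE(1)[OF H] that by auto
      have "c \<odot>\<^bsub>M\<^esub> x \<in> H \<inter> S i"
        using into[OF xM] submoduleE(4)[OF H c(1) that] by simp
      then show ?thesis
        using r c(1) xM by (simp add: module_ann_def smult_assoc1)
    qed
    then show ?thesis
      using r c(1) by (simp add: module_ann_def)
  qed
  have "a \<otimes> c \<oplus> b \<otimes> c = (a \<oplus> b) \<otimes> c"
    using carr c(1) by (simp add: R.l_distr)
  then have "c = a \<otimes> c \<oplus> b \<otimes> c"
    using ab c(1) by simp
  then show ?thesis
    using kill[OF N a] kill[OF L b] by (auto simp: set_add_def')
qed

theorem weakly_IN_direct_sum_iff:
  assumes ds: "is_direct_sum R M I S"
  shows "weakly_IN R M \<longleftrightarrow>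
    (\<forall>i\<in>I. weakly_IN R (M\<lparr>carrier := S i\<rparr>)) \<and>
    (\<forall>j\<in>I. \<forall>k\<in>I. j \<noteq> k \<longrightarrow> module_ann R M (S j) <+>\<^bsub>R\<^esub> module_ann R M (S k) = carrier R)"
proof
  assume w: "weakly_IN R M"
  then have "weakly_IN R (M\<lparr>carrier := S i\<rparr>)" if "i \<in> I" for i
    unfolding weakly_IN_restrict_carrier_iff[OF direct_sum_submodule[OF ds that]]
    by (simp add: weakly_IN_def)
  moreover have "module_ann R M (S j) <+>\<^bsub>R\<^esub> module_ann R M (S k) = carrier R"
    if "j \<in> I" "k \<in> I" "j \<noteq> k" for j k
    using w that direct_sum_submodule[OF ds] direct_sum_Int_zero[OF ds that]
    by (simp add: weakly_IN_def)
  ultimately show "(\<forall>i\<in>I. weakly_IN R (M\<lparr>carrier := S i\<rparr>)) \<and>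
    (\<forall>j\<in>I. \<forall>k\<in>I. j \<noteq> k \<longrightarrow> module_ann R M (S j) <+>\<^bsub>R\<^esub> module_ann R M (S k) = carrier R)"
    by blast
next
  assume A: "(\<forall>i\<in>I. weakly_IN R (M\<lparr>carrier := S i\<rparr>)) \<and>
    (\<forall>j\<in>I. \<forall>k\<in>I. j \<noteq> k \<longrightarrow> module_ann R M (S j) <+>\<^bsub>R\<^esub> module_ann R M (S k) = carrier R)"
  have fin: "finite I"
    using ds by (simp add: is_direct_sum_def)
  have annS: "ideal (module_ann R M (S i)) R" if "i \<in> I" for i
    using module_ann_ideal submoduleE(1)[OF direct_sum_submodule[OF ds that]] by blast
  show "weakly_IN R M"
    unfolding weakly_IN_def
  proof (intro allI impI)
    fix N L
    assume N: "submodule N R M" and L: "submodule L R M" and NL: "N \<inter> L = {\<zero>\<^bsub>M\<^esub>}"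
    note sub = submoduleE(1)[OF N] submoduleE(1)[OF L]
    define Q where "Q = module_ann R M N <+>\<^bsub>R\<^esub> module_ann R M L"
    interpret Q: ideal Q R
      unfolding Q_def using sub by (intro R.add_ideals module_ann_ideal)
    have "Q <+>\<^bsub>R\<^esub> module_ann R M (S i) = carrier R" if i: "i \<in> I" for i
    proof -
      have "\<exists>d\<in>module_ann R M (S i). \<exists>c\<in>carrier R.
          (\<forall>j\<in>I - {i}. c \<in> module_ann R M (S j)) \<and> d \<oplus> c = \<one>"
        using A fin i annS by (intro R.comaximal_Inter) auto
      \<comment> \<open>\<open>c\<close> acts on \<open>M\<close> as a projection onto \<open>S i\<close>: it kills the other summands, and it fixes
        \<open>S i\<close> because \<open>d\<close> kills \<open>S i\<close>.\<close>
      then obtain d c where d: "d \<in> module_ann R M (S i)" and c: "c \<in> carrier R"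
        "\<forall>j\<in>I - {i}. c \<in> module_ann R M (S j)" and dc: "d \<oplus> c = \<one>"
        by blast
      have "c \<in> Q"
        unfolding Q_def using A i c
        by (intro direct_sum_scalar_in_ann_sum[OF ds i _ N L NL]) auto
      moreover have "c \<oplus> d = \<one>"
        using c d dc by (simp add: module_ann_def R.a_comm)
      ultimately show ?thesis
        using R.ideal_sum_eq_carrier_iff[OF Q.is_ideal annS[OF i]] d by blast
    qed
    then have "\<exists>q\<in>Q. \<exists>r\<in>carrier R. (\<forall>i\<in>I. r \<in> module_ann R M (S i)) \<and> q \<oplus> r = \<one>"
      using annS by (intro R.comaximal_Inter[OF fin Q.is_ideal])
    then obtain q r where q: "q \<in> Q" and r: "r \<in> carrier R"
      "\<forall>i\<in>I. r \<in> module_ann R M (S i)" and qr: "q \<oplus> r = \<one>"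
      by blast
    have "r \<odot>\<^bsub>M\<^esub> x \<in> {\<zero>\<^bsub>M\<^esub>}" if "x \<in> carrier M" for x
    proof (rule direct_sum_smult_into_submodule[OF ds zero_submodule r(1) _ that])
      show "r \<odot>\<^bsub>M\<^esub> y \<in> {\<zero>\<^bsub>M\<^esub>}" if "i \<in> I" "y \<in> S i" for i y
        using r(2) that by (simp add: module_ann_def)
    qed
    then have "r \<in> module_ann R M N"
      using r(1) sub by (auto simp: module_ann_def)
    moreover have "\<zero> \<in> module_ann R M L"
      using sub by (auto simp: module_ann_def)
    moreover have "r = r \<oplus> \<zero>"
      using r(1) by simp
    ultimately have "r \<in> Q"
      unfolding Q_def set_add_def' by blast
    then have "\<one> \<in> Q"
      using q Q.a_closed[of q r] qr by simp
    then show "module_ann R M N <+>\<^bsub>R\<^esub> module_ann R M L = carrier R"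
      using Q.one_imp_carrier by (simp add: Q_def)
  qed
qed

end

theorem theorem3p1:
  fixes R :: "('a, 'c) ring_scheme"
    and M :: "('a, 'b, 'd) module_scheme"
    and S :: "nat \<Rightarrow> 'b set"
    and n :: nat
  assumes "cring R"
    and "module R M"
    and "is_direct_sum R M {1..n} S"
  shows "weakly_IN R M \<longleftrightarrow>
    (\<forall>i\<in>{1..n}. weakly_IN R (M\<lparr>carrier := S i\<rparr>)) \<and>
    (\<forall>j\<in>{1..n}. \<forall>k\<in>{1..n}. j \<noteq> k \<longrightarrow>
       module_ann R M (S j) <+>\<^bsub>R\<^esub> module_ann R M (S k) = carrier R)"
  using module.weakly_IN_direct_sum_iff[OF assms(2,3)] .

end
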